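(* Let $E$ be a nonzero real Banach space and let $A$ be a closed, quasidense, monotone subset of $E \times E^*$. Then $A$ is maximally monotone.
   Context: $E \times E^*$ is normed by $\|(x,x^* )\| := \sqrt{\|x\|^2 + \|x^*\|^2}$. A subset $A \subset E \times E^*$ is monotone if $\langle s - t, s^* - t^*\rangle \ge 0$ for all $(s,s^* ), (t,t^* ) \in A$, and maximally monotone if it is monotone and not properly contained in any monotone subset of $E \times E^*$. $A$ is quasidense (in $E \times E^*$) if, for all $(x,x^* ) \in E \times E^*$, $\inf_{(s,s^* ) \in A}\big[\frac12\|s-x\|^2 + \frac12\|s^*-x^*\|^2 + \langle s-x, s^*-x^*\rangle\big] \le 0$. *)

theory Defs
  imports "HOL-Analysis.Analysis"
begin

text \<open>
  The dual of \<open>'a\<close> is the type \<open>'a \<Rightarrow>\<^sub>L real\<close> of bounded linear functionals with the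
  operator norm. The library norm and topology on \<open>'a \<times> ('a \<Rightarrow>\<^sub>L real)\<close> are
  those of \<open>norm (x, x') = sqrt ((norm x)\<^sup>2 + (norm x')\<^sup>2)\<close> (see \<open>norm_prod_def\<close>).
\<close>

definition monotone_subset :: "('a::real_normed_vector \<times> ('a \<Rightarrow>\<^sub>L real)) set \<Rightarrow> bool" where
  "monotone_subset A \<longleftrightarrow>
     (\<forall>(s, s') \<in> A. \<forall>(t, t') \<in> A. 0 \<le> blinfun_apply (s' - t') (s - t))"

definition maximally_monotone :: "('a::real_normed_vector \<times> ('a \<Rightarrow>\<^sub>L real)) set \<Rightarrow> bool" where
  "maximally_monotone A \<longleftrightarrow>
     monotone_subset A \<and> \<not> (\<exists>B. monotone_subset B \<and> A \<subset> B)"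

text \<open>
  The infimum is taken in the extended reals, so that the infimum over the empty set is
  \<open>\<infinity>\<close> and the empty set is not quasidense; \<open>Inf {}\<close> on the reals has no
  such meaning.
\<close>

definition quasidense :: "('a::real_normed_vector \<times> ('a \<Rightarrow>\<^sub>L real)) set \<Rightarrow> bool" where
  "quasidense A \<longleftrightarrow>
     (\<forall>x x'. (INF (s, s') \<in> A.
        ereal (1 / 2 * (norm (s - x))\<^sup>2 + 1 / 2 * (norm (s' - x'))\<^sup>2
               + blinfun_apply (s' - x') (s - x))) \<le> 0)"

end

theory Submission
  imports Defs
begin

text \<open>
  Suppose that \<open>(x, x')\<close> is monotonically related to every point of \<open>A\<close>. Then the pairing
  term \<open>\<langle>s - x, s' - x'\<rangle>\<close> in the definition of quasidensity is nonnegative on \<open>A\<close>, so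
  that what remains, half the squared distance from \<open>(s, s')\<close> to \<open>(x, x')\<close>, also has infimum
  at most \<open>0\<close> over \<open>A\<close>. Hence \<open>(x, x')\<close> lies in the closure of \<open>A\<close>
  (\<open>monotonically_related_in_closure\<close>). If \<open>A\<close> is closed, it already contains every such
  point, and in particular every point of any monotone superset.
\<close>

lemma monotone_subsetD:
  assumes "monotone_subset A" "(s, s') \<in> A" "(t, t') \<in> A"
  shows "0 \<le> blinfun_apply (s' - t') (s - t)"
  using assms unfolding monotone_subset_def by blast

lemma quasidenseE:
  assumes "quasidense A" and "0 < e"
  obtains s s' where "(s, s') \<in> A"
    and "1 / 2 * (norm (s - x))\<^sup>2 + 1 / 2 * (norm (s' - x'))\<^sup>2
           + blinfun_apply (s' - x') (s - x) < e"
proof -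
  have "(INF (s, s') \<in> A.
      ereal (1 / 2 * (norm (s - x))\<^sup>2 + 1 / 2 * (norm (s' - x'))\<^sup>2
             + blinfun_apply (s' - x') (s - x))) \<le> 0"
    using assms(1) unfolding quasidense_def by blast
  also have "0 < ereal e"
    using assms(2) by simp
  finally show thesis
    using that by (auto simp: INF_less_iff)
qed

lemma monotonically_related_in_closure:
  assumes quasidense: "quasidense A"
    and related: "\<And>s s'. (s, s') \<in> A \<Longrightarrow> 0 \<le> blinfun_apply (s' - x') (s - x)"
  shows "(x, x') \<in> closure A"
  unfolding closure_approachable
proof (intro allI impI)
  fix e :: real
  assume "0 < e"
  \<comment> \<open>The tolerance is half of \<open>e\<^sup>2\<close> because the functional bounds half of the squared distance.\<close>
  then have "0 < e\<^sup>2 / 2"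
    by simp
  then obtain s s' where s: "(s, s') \<in> A"
    and small: "1 / 2 * (norm (s - x))\<^sup>2 + 1 / 2 * (norm (s' - x'))\<^sup>2
      + blinfun_apply (s' - x') (s - x) < e\<^sup>2 / 2"
    by (rule quasidenseE[OF quasidense])
  have "(dist (s, s') (x, x'))\<^sup>2 = (norm (s - x))\<^sup>2 + (norm (s' - x'))\<^sup>2"
    by (simp add: dist_prod_def dist_norm)
  also have "\<dots> < e\<^sup>2"
    using small related[OF s] by linarith
  finally have "dist (s, s') (x, x') < e"
    using \<open>0 < e\<close> by (simp add: power_less_imp_less_base)
  with s show "\<exists>y\<in>A. dist y (x, x') < e"
    by blast
qed

theorem theorem6p1:
  fixes A :: "('a::banach \<times> ('a \<Rightarrow>\<^sub>L real)) set"
  assumes "\<exists>x::'a. x \<noteq> 0"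
    and "closed A"
    and "quasidense A"
    and "monotone_subset A"
  shows "maximally_monotone A"
  unfolding maximally_monotone_def
proof (intro conjI notI)
  show "monotone_subset A"
    by fact
next
  assume "\<exists>B. monotone_subset B \<and> A \<subset> B"
  then obtain B where B: "monotone_subset B" "A \<subset> B"
    by blast
  then obtain x x' where x: "(x, x') \<in> B" "(x, x') \<notin> A"
    by auto
  have "(x, x') \<in> closure A"
    using assms(3)
  proof (rule monotonically_related_in_closure)
    fix s s'
    assume "(s, s') \<in> A"
    with B(2) have "(s, s') \<in> B"
      by blast
    with B(1) show "0 \<le> blinfun_apply (s' - x') (s - x)"
      using x(1) by (rule monotone_subsetD)
  qed
  with \<open>closed A\<close> x(2) show False
    by simp
qed

end
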